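(* For any constant $\varepsilon \in (0,1)$, there exist edge-weighted trees for which any $(3-\varepsilon)$-spanner using $k < n/2$ Steiner points has complexity $\Omega(mn/k)$. Precisely: for every $\varepsilon\in(0,1)$ there are constants $c, C>0$ such that for all positive integers $n,m,k$ with $k<n/2$ and $m\ge Cn$ there is an edge-weighted rooted tree $T$ with $n$ leaves and $m$ vertices such that every $(3-\varepsilon)$-spanner for $T$ using $k$ Steiner points has complexity at least $c\, mn/k$.
   Context: Let $T$ be a rooted tree with positive edge weights; the sites $S$ are its leaves. The distance $d(p,q)$ between two points of $T$ is the total weight of the unique path $\pi(p,q)$ between them. A Steiner point may be any vertex of $T$ or a point in the interior of an edge; placing a Steiner point $s$ in the interior of an edge $(u,v)$ of weight $w$ replaces this edge by edges $(u,s)$ and $(s,v)$ of weights $\delta w$ and $(1-\delta)w$ for some $\delta\in(0,1)$. A spanner for $T$ with Steiner point set $\mathcal{S}$ is a graph $\mathcal{G}$ with vertex set $S\cup\mathcal{S}$; its edges are called links. A link $(p,q)$ represents the path $\pi(p,q)$: its length is $d(p,q)$ and its complexity is the number of edges of $\pi(p,q)$. $\mathcal{G}$ is a $\tau$-spanner if $d_{\mathcal{G}}(p,q)\le \tau\, d(p,q)$ for all sites $p,q\in S$, where $d_{\mathcal G}$ is the shortest-path distance in $\mathcal{G}$ (no requirement is made for distances involving Steiner points). The complexity of $\mathcal{G}$ is the sum of the complexities of its links. *)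

theory Defs
  imports "Graph_Theory.Graph_Theory"
begin

text \<open>
  An undirected simple graph is a \<^locale>\<open>pair_graph\<close>: each edge is a pair of antiparallel arcs.
  Any such pair is a \<^const>\<open>pre_digraph.cycle\<close> of length 2, so the acyclicity of an undirected
  tree only excludes cycles of length at least 3; the notion \<^const>\<open>tree\<close> of the library, which
  excludes directed cycles of every length, does not fit here.
\<close>

locale rooted_tree = pair_graph T
  for T :: "'a pair_pre_digraph" and r :: 'a and w :: "('a \<times> 'a) weight_fun" +
  assumes connected_tree: "Digraph_Component.connected (with_proj T)"
    and no_cycle: "cycle p \<Longrightarrow> length p < 3"
    and root_in_verts: "r \<in> pverts T"
    and weight_sym: "(u, v) \<in> parcs T \<Longrightarrow> w (u, v) = w (v, u)"
    and weight_pos: "e \<in> parcs T \<Longrightarrow> 0 < w e"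

text \<open>A leaf is a vertex without children; every neighbour other than the parent is a child.\<close>

definition leaves :: "'a pair_pre_digraph \<Rightarrow> 'a \<Rightarrow> 'a set" where
  "leaves T r =
    {v \<in> pverts T. out_degree (with_proj T) v = (if v = r then 0 else 1)}"

definition tree_path :: "'a pair_pre_digraph \<Rightarrow> 'a \<Rightarrow> 'a \<Rightarrow> ('a \<times> 'a) awalk" where
  "tree_path T p q = (THE es. pre_digraph.apath (with_proj T) p es q)"

definition tree_dist :: "'a pair_pre_digraph \<Rightarrow> ('a \<times> 'a) weight_fun \<Rightarrow> 'a \<Rightarrow> 'a \<Rightarrow> real" where
  "tree_dist T w p q = wf_digraph.awalk_cost w (tree_path T p q)"

text \<open>
  \<open>steiner_placement T w T' w'\<close>: the weighted tree \<open>(T', w')\<close> arises from \<open>(T, w)\<close> by successively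
  placing points in the interior of edges. These points are the vertices of \<open>T'\<close> outside \<open>T\<close>.
\<close>

inductive steiner_placement ::
  "'a pair_pre_digraph \<Rightarrow> ('a \<times> 'a) weight_fun \<Rightarrow>
   'a pair_pre_digraph \<Rightarrow> ('a \<times> 'a) weight_fun \<Rightarrow> bool"
  for T :: "'a pair_pre_digraph" and w :: "('a \<times> 'a) weight_fun"
where
  none: "steiner_placement T w T w"
| place: "\<lbrakk>steiner_placement T w T' w'; (u, v) \<in> parcs T'; s \<notin> pverts T'; 0 < \<delta>; \<delta> < 1\<rbrakk> \<Longrightarrow>
    steiner_placement T w (subdivide T' (u, v) s)
      (w'((u, s) := \<delta> * w' (u, v), (s, u) := \<delta> * w' (u, v),
          (s, v) := (1 - \<delta>) * w' (u, v), (v, s) := (1 - \<delta>) * w' (u, v)))"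

text \<open>
  \<open>G\<close> is a \<open>\<tau>\<close>-spanner for the tree \<open>(T, w)\<close> with Steiner point set \<open>S\<close>, and \<open>(T', w')\<close> is the
  tree after the placement of \<open>S\<close>. A Steiner point is a vertex of \<open>T\<close> or one of the placed
  points, and all placed points are Steiner points. Unreachable sites are at distance \<open>\<infinity>\<close> in \<open>G\<close>.
\<close>

definition steiner_spanner ::
  "real \<Rightarrow> 'a pair_pre_digraph \<Rightarrow> 'a \<Rightarrow> ('a \<times> 'a) weight_fun \<Rightarrow>
   'a set \<Rightarrow> 'a pair_pre_digraph \<Rightarrow> ('a \<times> 'a) weight_fun \<Rightarrow> 'a pair_pre_digraph \<Rightarrow> bool" where
  "steiner_spanner \<tau> T r w S T' w' G \<longleftrightarrow>
     steiner_placement T w T' w' \<and>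
     pverts T' - pverts T \<subseteq> S \<and> S \<subseteq> pverts T' \<and>
     pair_graph G \<and> pverts G = leaves T r \<union> S \<and>
     (\<forall>p \<in> leaves T r. \<forall>q \<in> leaves T r.
        wf_digraph.\<mu> (with_proj G) (\<lambda>(a, b). tree_dist T' w' a b) p q
          \<le> ereal (\<tau> * tree_dist T w p q))"

text \<open>Every link is counted by both of its arcs, hence the factor 1/2.\<close>

definition spanner_complexity :: "'a pair_pre_digraph \<Rightarrow> 'a pair_pre_digraph \<Rightarrow> real" where
  "spanner_complexity T' G = (\<Sum>(p, q) \<in> parcs G. real (length (tree_path T' p q))) / 2"

end

theory Submission
  imports Defs
begin

text \<open>
  The tree is a caterpillar: a spine with many vertices but tiny total weight, to which bunches of
  leaves are attached at distance 1, at \<open>K = min n (3 k)\<close> equally spaced spine vertices. All leaves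
  have distance about 2 from each other. If two leaves of different bunches without Steiner points
  nearby only had links inside of their regions, then every path in the spanner between them would
  pass through two further leaves and have length at least 6. Hence all leaves of all Steiner-free
  bunches, except for one bunch, have a link that leaves their region, and such a link has
  complexity of order \<open>m / K\<close>. A constant fraction of the bunches is free of Steiner points.

  Distances and numbers of edges in a tree with Steiner points are bounded from below by means of
  Lipschitz functions, which extend along subdivisions of edges.
\<close>

section \<open>Trees as connected graphs of bridges\<close>

lemma (in wf_digraph) awalk_crosses_cut:
  assumes "awalk a es b" "a \<in> X" "b \<notin> X"
  shows "\<exists>e \<in> set es. tail G e \<in> X \<and> head G e \<notin> X"
  using assms by (induction es arbitrary: a) (auto simp: awalk_simps)

text \<open>The triangle inequality, summed along the walk. The lower bounds on distances, path
  lengths and spanner walks all rest on it.\<close>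

lemma (in wf_digraph) Lipschitz_le_awalk_cost:
  fixes f :: "'a \<Rightarrow> real"
  assumes "awalk u es v"
    and "\<And>e. e \<in> arcs G \<Longrightarrow> \<bar>f (tail G e) - f (head G e)\<bar> \<le> c e"
  shows "\<bar>f u - f v\<bar> \<le> awalk_cost c es"
  using assms(1)
proof (induction es arbitrary: u)
  case (Cons e es)
  then have "\<bar>f (head G e) - f v\<bar> \<le> awalk_cost c es" "\<bar>f u - f (head G e)\<bar> \<le> c e"
    using assms(2)[of e] by (auto simp: awalk_simps)
  then show ?case by simp
qed (simp add: awalk_simps)

text \<open>Acyclicity in the form of a one-way cut for every arc: such cuts are easy to carry
  through a subdivision and yield uniqueness of simple paths.\<close>

locale bridge_tree = pair_graph T for T :: "'a pair_pre_digraph" +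
  assumes reach: "u \<in> pverts T \<Longrightarrow> v \<in> pverts T \<Longrightarrow> u \<rightarrow>\<^sup>*\<^bsub>T\<^esub> v"
    and bridge: "(u, v) \<in> parcs T \<Longrightarrow>
      \<exists>X. u \<in> X \<and> v \<notin> X \<and> (\<forall>a b. (a, b) \<in> parcs T \<longrightarrow> a \<in> X \<longrightarrow> b \<notin> X \<longrightarrow> a = u \<and> b = v)"
begin

text \<open>The rest of the first path avoids \<open>p\<close>, so it never re-enters the cut
  \<open>X\<close> of its first arc \<open>(p, a)\<close>, and \<open>q\<close> lies outside
  \<open>X\<close>. The second path must leave \<open>X\<close> through \<open>(p, a)\<close>; as it
  visits \<open>p\<close> only once, this is its first arc.\<close>

lemma apath_unique:
  assumes "apath p es q" "apath p fs q"
  shows "es = fs"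
  using assms
proof (induction es arbitrary: p fs)
  case Nil
  then show ?case by (metis apath_Nil_iff apath_nonempty_ends)
next
  case (Cons e es)
  then have "p \<noteq> q" by (metis apath_nonempty_ends list.distinct(1))
  with Cons.prems obtain f fs' where fs: "fs = f # fs'"
    by (cases fs) (auto simp: apath_Nil_iff)
  obtain a where e: "e = (p, a)" and pa: "(p, a) \<in> parcs T" and es: "awalk a es q"
    and nes: "p \<notin> set (awalk_verts a es)" "apath a es q"
    using Cons.prems(1) by (cases e) (auto simp: apath_Cons_iff awalkI_apath)
  obtain b where f: "f = (p, b)" and pb: "(p, b) \<in> parcs T" and fs': "awalk b fs' q"
    and nfs: "p \<notin> set (awalk_verts b fs')" "apath b fs' q"
    using Cons.prems(2) fs by (cases f) (auto simp: apath_Cons_iff awalkI_apath)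
  obtain X where X: "p \<in> X" "a \<notin> X"
    and cross: "\<And>c d. (c, d) \<in> parcs T \<Longrightarrow> c \<in> X \<Longrightarrow> d \<notin> X \<Longrightarrow> c = p \<and> d = a"
    using bridge[OF pa] by blast
  have "q \<notin> X"
  proof
    assume "q \<in> X"
    then obtain c d where cd: "(c, d) \<in> set es" "c \<notin> X" "d \<in> X"
      using awalk_crosses_cut[OF es, of "- X"] X(2) by auto
    then have "(d, c) \<in> parcs T" using es by (auto simp: awalk_def intro: arcs_symmetric)
    then have "d = p" using cross cd by blast
    then show False using cd(1) nes(1) awalk_verts_arc2[OF es cd(1)] by simp
  qed
  have "a = b"
  proof (rule ccontr)
    assume "a \<noteq> b"
    then have "b \<in> X" using cross pb X(1) by blast
    then obtain c d where cd: "(c, d) \<in> set fs'" "c \<in> X" "d \<notin> X"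
      using awalk_crosses_cut[OF fs', of X] \<open>q \<notin> X\<close> by auto
    then have "c = p" using cross fs' by (auto simp: awalk_def)
    then show False using nfs(1) awalk_verts_arc1[OF cd(1)] by simp
  qed
  then show ?case using Cons.IH nes(2) nfs(2) e f fs by simp
qed

text \<open>Without its first arc \<open>(u, v)\<close>, a cycle is a simple path from
  \<open>v\<close> to \<open>u\<close>; the reversed arc is the only such path.\<close>

lemma cycle_length_less_3:
  assumes "cycle p"
  shows "length p < 3"
proof -
  obtain u e es where p: "p = e # es" and walk: "awalk u p u"
    and dist: "distinct (tl (awalk_verts u p))"
    using assms unfolding cycle_def by (metis list.exhaust)
  obtain v where e: "e = (u, v)" and uv: "(u, v) \<in> parcs T" and "apath v es u"
    using p walk dist by (cases e) (auto simp: awalk_simps apath_def)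
  moreover have "apath v [(v, u)] u"
    using arcs_symmetric[OF uv] no_loops'[OF uv] in_arcsD1[OF uv]
    by (auto simp: apath_simps)
  ultimately have "es = [(v, u)]" by (blast intro: apath_unique)
  then show ?thesis using p by simp
qed

section \<open>Tree paths and bounds on their cost and length\<close>

lemma apath_tree_path:
  assumes "p \<in> pverts T" "q \<in> pverts T"
  shows "apath p (tree_path T p q) q"
proof -
  have "\<exists>!es. apath p es q" using reach[OF assms] apath_unique reachable_apath by metis
  then show ?thesis unfolding tree_path_def by (rule theI')
qed

text \<open>Some cheapest walk is simple, and the only simple path is the tree path.\<close>

lemma tree_dist_le_awalk_cost:
  assumes "awalk p es q" "\<And>e. e \<in> parcs T \<Longrightarrow> 0 \<le> w e"
  shows "tree_dist T w p q \<le> awalk_cost w es"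
proof -
  have verts: "p \<in> pverts T" "q \<in> pverts T"
    using assms(1) awalk_hd_in_verts awalk_last_in_verts by blast+
  then obtain ps where "apath p ps q" "\<mu> w p q = awalk_cost w ps"
    using min_cost_awalk[of p q w] reach assms(2) by auto
  moreover have "ps = tree_path T p q"
    using calculation verts apath_tree_path apath_unique by blast
  ultimately show ?thesis
    using min_cost_le_walk_cost[OF assms(1), of w] by (simp add: tree_dist_def)
qed

lemma Lipschitz_le_tree_dist:
  fixes f :: "'a \<Rightarrow> real"
  assumes "p \<in> pverts T" "q \<in> pverts T"
    and "\<And>a b. (a, b) \<in> parcs T \<Longrightarrow> \<bar>f a - f b\<bar> \<le> w (a, b)"
  shows "\<bar>f p - f q\<bar> \<le> tree_dist T w p q"
  unfolding tree_dist_def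
  using apath_tree_path[OF assms(1,2)] assms(3)
  by (intro Lipschitz_le_awalk_cost) (auto intro: awalkI_apath)

lemma Lipschitz_le_length_tree_path:
  fixes f :: "'a \<Rightarrow> real"
  assumes "p \<in> pverts T" "q \<in> pverts T"
    and "\<And>a b. (a, b) \<in> parcs T \<Longrightarrow> \<bar>f a - f b\<bar> \<le> 1"
  shows "\<bar>f p - f q\<bar> \<le> length (tree_path T p q)"
proof -
  have "awalk_cost (\<lambda>_. 1) es = length es" for es :: "('a \<times> 'a) list"
    by (induction es) auto
  then show ?thesis
    using Lipschitz_le_tree_dist[OF assms(1,2), of f "\<lambda>_. 1"] assms(3)
    by (simp add: tree_dist_def)
qed

text \<open>A cut for the divided edge serves both halves once \<open>s\<close> is put on the proper
  side; any other cut has \<open>u\<close> and \<open>v\<close> on one side, where \<open>s\<close>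
  joins them.\<close>

lemma bridge_tree_subdivide:
  assumes uv: "(u, v) \<in> parcs T" and s: "s \<notin> pverts T"
  shows "bridge_tree (subdivide T (u, v) s)"
proof -
  let ?T = "subdivide T (u, v) s"
  interpret S: pair_graph ?T using assms by (rule pair_graph_subdivide)
  have old: "a \<rightarrow>\<^sup>*\<^bsub>?T\<^esub> b" if "a \<in> pverts T" "b \<in> pverts T" for a b
    using apath_sd_path[OF _ assms] reach[OF that] S.reachable_apath reachable_apath by metis
  have vu: "(v, u) \<in> parcs T" using uv by (rule arcs_symmetric)
  have ends: "u \<in> pverts T" "v \<in> pverts T" "u \<noteq> v" "u \<noteq> s" "v \<noteq> s"
    using uv s no_loops'[OF uv] wellformed'[OF uv] by auto
  have us: "u \<rightarrow>\<^sup>*\<^bsub>?T\<^esub> s" "s \<rightarrow>\<^sup>*\<^bsub>?T\<^esub> u" by (auto intro!: S.reachable_adjI)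
  have no_s: "(a, s) \<notin> parcs T" "(s, a) \<notin> parcs T" for a
    using wellformed'[of a s] wellformed'[of s a] s by auto
  have half: "\<exists>X. x \<in> X \<and> y \<notin> X \<and>
      (\<forall>a b. (a, b) \<in> parcs ?T \<longrightarrow> a \<in> X \<longrightarrow> b \<notin> X \<longrightarrow> a = x \<and> b = y)"
    if "(p, q) = (u, v) \<or> (p, q) = (v, u)" and xy: "(x, y) = (p, s) \<or> (x, y) = (s, q)" for p q x y
  proof -
    have pq: "(p, q) \<in> parcs T" using that(1) uv vu by auto
    obtain X where X: "p \<in> X" "q \<notin> X"
      and cross: "\<And>a b. (a, b) \<in> parcs T \<Longrightarrow> a \<in> X \<Longrightarrow> b \<notin> X \<Longrightarrow> a = p \<and> b = q"
      using bridge[OF pq] by blast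
    show ?thesis
    proof (cases "(x, y) = (p, s)")
      case True
      \<comment> \<open>\<open>X\<close> is arbitrary outside of the tree, so it may or may not
        contain \<open>s\<close>; the first half needs \<open>s\<close> outside, the second half
        needs it inside.\<close>
      show ?thesis
        by (rule exI[of _ "X - {s}"]) (use True X that(1) ends no_s in \<open>auto dest: cross\<close>)
    next
      case False
      with xy have "(x, y) = (s, q)" by blast
      then show ?thesis
        by (intro exI[of _ "insert s X"]) (use X that(1) ends no_s in \<open>auto dest: cross\<close>)
    qed
  qed
  show ?thesis
  proof
    show "a \<rightarrow>\<^sup>*\<^bsub>?T\<^esub> b" if "a \<in> pverts ?T" "b \<in> pverts ?T" for a b
    proof -
      have "a \<rightarrow>\<^sup>*\<^bsub>?T\<^esub> u" "u \<rightarrow>\<^sup>*\<^bsub>?T\<^esub> b"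
        using that old us ends by auto
      then show ?thesis by (rule S.reachable_trans)
    qed
    fix x y assume "(x, y) \<in> parcs ?T"
    then consider "(x, y) \<in> parcs T" "(x, y) \<noteq> (u, v)" "(x, y) \<noteq> (v, u)"
      | "(x, y) = (u, s) \<or> (x, y) = (s, v)" | "(x, y) = (v, s) \<or> (x, y) = (s, u)" by auto
    then show "\<exists>X. x \<in> X \<and> y \<notin> X \<and>
        (\<forall>a b. (a, b) \<in> parcs ?T \<longrightarrow> a \<in> X \<longrightarrow> b \<notin> X \<longrightarrow> a = x \<and> b = y)"
    proof cases
      case 1
      obtain X where X: "x \<in> X" "y \<notin> X"
        and cross: "\<And>a b. (a, b) \<in> parcs T \<Longrightarrow> a \<in> X \<Longrightarrow> b \<notin> X \<Longrightarrow> a = x \<and> b = y"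
        using bridge[OF 1(1)] by blast
      \<comment> \<open>Otherwise \<open>(u, v)\<close> or \<open>(v, u)\<close> would leave
        \<open>X\<close>, which only \<open>(x, y)\<close> does.\<close>
      have "u \<in> X \<longleftrightarrow> v \<in> X" using cross[OF uv] cross[OF vu] 1 by auto
      have "x \<noteq> s" "y \<noteq> s" using 1(1) no_s by auto
      let ?X = "if u \<in> X then insert s X else X - {s}"
      show ?thesis
      proof (intro exI[of _ ?X] conjI allI impI)
        show "x \<in> ?X" "y \<notin> ?X" using X \<open>x \<noteq> s\<close> \<open>y \<noteq> s\<close> by auto
        fix a b assume ab: "(a, b) \<in> parcs ?T" "a \<in> ?X" "b \<notin> ?X"
        have "a \<noteq> s" "b \<noteq> s"
          using ab \<open>u \<in> X \<longleftrightarrow> v \<in> X\<close> ends no_s by (auto split: if_splits)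
        then have "(a, b) \<in> parcs T" "a \<in> X" "b \<notin> X"
          using ab by (auto split: if_splits)
        then show "a = x" "b = y" using cross by blast+
      qed
    next
      case 2
      then show ?thesis by (intro half[of u v]) simp_all
    next
      case 3
      then show ?thesis by (intro half[of v u]) simp_all
    qed
  qed
qed

end

section \<open>Lipschitz functions and Steiner points\<close>

lemma steiner_placement_bridge_tree:
  assumes "steiner_placement T w T' w'" "bridge_tree T"
  shows "bridge_tree T' \<and> pverts T \<subseteq> pverts T'"
  using assms by induction (auto intro: bridge_tree.bridge_tree_subdivide)

text \<open>The extension is linear along each edge of \<open>T\<close>.\<close>

lemma steiner_placement_extend_Lipschitz:
  fixes f :: "'a \<Rightarrow> real"
  assumes "steiner_placement T w T' w'" "bridge_tree T"
  obtains g where "\<And>v. v \<in> pverts T \<Longrightarrow> g v = f v"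
    and "\<And>c a b. (\<And>a b. (a, b) \<in> parcs T \<Longrightarrow> \<bar>f a - f b\<bar> \<le> c) \<Longrightarrow>
      (a, b) \<in> parcs T' \<Longrightarrow> \<bar>g a - g b\<bar> \<le> c"
    and "\<And>a b. (\<And>a b. (a, b) \<in> parcs T \<Longrightarrow> \<bar>f a - f b\<bar> \<le> w (a, b)) \<Longrightarrow>
      (a, b) \<in> parcs T' \<Longrightarrow> \<bar>g a - g b\<bar> \<le> w' (a, b)"
proof -
  \<comment> \<open>The two bounds are implications because a given \<open>f\<close> may satisfy
    only one of them: a constant bound serves to count edges, the bound by weights to measure
    distances.\<close>
  have "\<exists>g. (\<forall>v \<in> pverts T. g v = f v) \<and>
    (\<forall>c. (\<forall>a b. (a, b) \<in> parcs T \<longrightarrow> \<bar>f a - f b\<bar> \<le> c) \<longrightarrow> (\<forall>a b. (a, b) \<in> parcs T' \<longrightarrow> \<bar>g a - g b\<bar> \<le> c)) \<and>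
    ((\<forall>a b. (a, b) \<in> parcs T \<longrightarrow> \<bar>f a - f b\<bar> \<le> w (a, b)) \<longrightarrow>
      (\<forall>a b. (a, b) \<in> parcs T' \<longrightarrow> \<bar>g a - g b\<bar> \<le> w' (a, b)))"
    using assms
  proof induction
    case none
    show ?case by (rule exI[of _ f]) auto
  next
    case (place T' w' u v s \<delta>)
    from place.IH[OF \<open>bridge_tree T\<close>]
    obtain g where g: "\<forall>v \<in> pverts T. g v = f v"
      and hop: "\<forall>c. (\<forall>a b. (a, b) \<in> parcs T \<longrightarrow> \<bar>f a - f b\<bar> \<le> c) \<longrightarrow>
        (\<forall>a b. (a, b) \<in> parcs T' \<longrightarrow> \<bar>g a - g b\<bar> \<le> c)"
      and wt: "(\<forall>a b. (a, b) \<in> parcs T \<longrightarrow> \<bar>f a - f b\<bar> \<le> w (a, b)) \<longrightarrow>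
        (\<forall>a b. (a, b) \<in> parcs T' \<longrightarrow> \<bar>g a - g b\<bar> \<le> w' (a, b))"
      by (elim exE conjE) (rule that)
    from place have T': "bridge_tree T'" and sub: "pverts T \<subseteq> pverts T'"
      using steiner_placement_bridge_tree by blast+
    interpret T': bridge_tree T' by (rule T')
    \<comment> \<open>Each half of the edge receives the same fraction of the change of
      \<open>g\<close> as of the weight.\<close>
    define g' where "g' = g(s := g u + \<delta> * (g v - g u))"
    have ends: "u \<noteq> v" "u \<noteq> s" "v \<noteq> s"
      using place.hyps T'.no_loops'[of u v] T'.wellformed'[of u v] by auto
    have old: "g' a = g a" "g' b = g b" "a \<noteq> s" "b \<noteq> s" if "(a, b) \<in> parcs T'" for a b
      using T'.wellformed'[OF that] \<open>s \<notin> pverts T'\<close> by (auto simp: g'_def)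
    have us: "\<bar>g' u - g' s\<bar> = \<delta> * \<bar>g u - g v\<bar>"
    proof -
      have "g' u - g' s = \<delta> * (g u - g v)" using ends by (simp add: g'_def algebra_simps)
      then show ?thesis using \<open>0 < \<delta>\<close> by (simp add: abs_mult)
    qed
    have sv: "\<bar>g' s - g' v\<bar> = (1 - \<delta>) * \<bar>g u - g v\<bar>"
    proof -
      have "g' s - g' v = (1 - \<delta>) * (g u - g v)" using ends by (simp add: g'_def algebra_simps)
      then show ?thesis using \<open>\<delta> < 1\<close> by (simp add: abs_mult)
    qed
    note su = us[unfolded abs_minus_commute[of "g' u"]]
    note vs = sv[unfolded abs_minus_commute[of "g' s"]]
    show ?case
    proof (intro exI[of _ g'] conjI allI impI ballI)
      show "g' v = f v" if "v \<in> pverts T" for v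
        using that sub g \<open>s \<notin> pverts T'\<close> by (auto simp: g'_def)
      fix c a b assume *: "\<forall>a b. (a, b) \<in> parcs T \<longrightarrow> \<bar>f a - f b\<bar> \<le> c"
        and e: "(a, b) \<in> parcs (subdivide T' (u, v) s)"
      have uv: "\<bar>g u - g v\<bar> \<le> c" using hop * \<open>(u, v) \<in> parcs T'\<close> by blast
      have "\<delta> * \<bar>g u - g v\<bar> \<le> 1 * c" "(1 - \<delta>) * \<bar>g u - g v\<bar> \<le> 1 * c"
        using uv \<open>0 < \<delta>\<close> \<open>\<delta> < 1\<close> by (intro mult_mono; simp)+
      then show "\<bar>g' a - g' b\<bar> \<le> c"
        using e hop[rule_format, OF *[rule_format]] us su sv vs old by auto
    next
      fix a b assume *: "\<forall>a b. (a, b) \<in> parcs T \<longrightarrow> \<bar>f a - f b\<bar> \<le> w (a, b)"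
        and e: "(a, b) \<in> parcs (subdivide T' (u, v) s)"
      have uv: "\<bar>g u - g v\<bar> \<le> w' (u, v)" using wt * \<open>(u, v) \<in> parcs T'\<close> by blast
      then have uv': "\<delta> * \<bar>g u - g v\<bar> \<le> \<delta> * w' (u, v)"
        "(1 - \<delta>) * \<bar>g u - g v\<bar> \<le> (1 - \<delta>) * w' (u, v)"
        using \<open>0 < \<delta>\<close> \<open>\<delta> < 1\<close> by auto
      consider "(a, b) \<in> parcs T'" | "(a, b) = (u, s)" | "(a, b) = (s, u)"
        | "(a, b) = (s, v)" | "(a, b) = (v, s)" using e by auto
      then show "\<bar>g' a - g' b\<bar> \<le>
          (w'((u, s) := \<delta> * w' (u, v), (s, u) := \<delta> * w' (u, v),
          (s, v) := (1 - \<delta>) * w' (u, v), (v, s) := (1 - \<delta>) * w' (u, v))) (a, b)"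
      proof cases
        case 1
        then have "\<bar>g a - g b\<bar> \<le> w' (a, b)" using wt * by blast
        then show ?thesis using old[OF 1] by simp
      qed (use uv' us su sv vs ends in simp_all)
    qed
  qed
  then obtain g where g: "\<forall>v \<in> pverts T. g v = f v"
    and hop: "\<forall>c. (\<forall>a b. (a, b) \<in> parcs T \<longrightarrow> \<bar>f a - f b\<bar> \<le> c) \<longrightarrow>
      (\<forall>a b. (a, b) \<in> parcs T' \<longrightarrow> \<bar>g a - g b\<bar> \<le> c)"
    and wt: "(\<forall>a b. (a, b) \<in> parcs T \<longrightarrow> \<bar>f a - f b\<bar> \<le> w (a, b)) \<longrightarrow>
      (\<forall>a b. (a, b) \<in> parcs T' \<longrightarrow> \<bar>g a - g b\<bar> \<le> w' (a, b))"
    by (elim exE conjE) (rule that)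
  show ?thesis
  proof (rule that[of g])
    show "g v = f v" if "v \<in> pverts T" for v using g that by blast
    show "\<bar>g a - g b\<bar> \<le> c"
      if "\<And>a b. (a, b) \<in> parcs T \<Longrightarrow> \<bar>f a - f b\<bar> \<le> c" "(a, b) \<in> parcs T'" for c a b
      using hop that by blast
    show "\<bar>g a - g b\<bar> \<le> w' (a, b)"
      if "\<And>a b. (a, b) \<in> parcs T \<Longrightarrow> \<bar>f a - f b\<bar> \<le> w (a, b)" "(a, b) \<in> parcs T'" for a b
      using wt that by blast
  qed
qed

section \<open>Caterpillars\<close>

text \<open>
  The spine is \<open>0, \<dots>, M - 1\<close>, rooted at \<open>M - 1\<close>, with edges of weight \<open>\<eta>\<close>; the leaf \<open>M + j\<close> hangs
  from the spine vertex \<open>a j\<close> by an edge of weight 1. The assumption \<open>a 0 = 0\<close> prevents the spine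
  vertex 0 from being a leaf.
\<close>

locale caterpillar =
  fixes M n :: nat and a :: "nat \<Rightarrow> nat" and \<eta> :: real
  assumes two_le_M: "2 \<le> M" and n_pos: "0 < n" and a_0: "a 0 = 0"
    and a_less: "j < n \<Longrightarrow> a j < M" and \<eta>_pos: "0 < \<eta>"
begin

text \<open>The parent. At the root \<open>M - 1\<close> the value is meaningless, hence the
  recurring side condition \<open>v \<noteq> M - 1\<close>.\<close>

definition up :: "nat \<Rightarrow> nat" where
  "up v = (if v < M then Suc v else a (v - M))"

definition T :: "nat pair_pre_digraph" where
  "T = \<lparr>pverts = {..<M + n},
    parcs = {(p, q). p < M + n \<and> p \<noteq> M - 1 \<and> q = up p \<or> q < M + n \<and> q \<noteq> M - 1 \<and> p = up q}\<rparr>"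

definition w :: "(nat \<times> nat) weight_fun" where
  "w = (\<lambda>(p, q). if p < M \<and> q < M then \<eta> else 1)"

text \<open>The projection to the spine, used as a coordinate along it.\<close>

definition foot :: "nat \<Rightarrow> nat" where
  "foot v = (if v < M then v else a (v - M))"

lemma pverts_T: "pverts T = {..<M + n}" by (simp add: T_def)

lemma parcs_T: "(p, q) \<in> parcs T \<longleftrightarrow>
    p < M + n \<and> p \<noteq> M - 1 \<and> q = up p \<or> q < M + n \<and> q \<noteq> M - 1 \<and> p = up q"
  by (simp add: T_def)

lemma up_less: "v < M + n \<Longrightarrow> v \<noteq> M - 1 \<Longrightarrow> up v < M"
  using a_less[of "v - M"] by (auto simp: up_def)

lemma up_neq: "v < M + n \<Longrightarrow> v \<noteq> M - 1 \<Longrightarrow> up v \<noteq> v"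
  using up_less[of v] by (auto simp: up_def)

lemma foot_less: "v < M + n \<Longrightarrow> foot v < M"
  using a_less[of "v - M"] by (auto simp: foot_def)

sublocale pair_graph T
proof
  have sub: "parcs T \<subseteq> {..<M + n} \<times> {..<M + n}"
    using up_less by (fastforce simp: parcs_T)
  then show "fst e \<in> pverts T" "snd e \<in> pverts T" if "e \<in> parcs T" for e
    using that by (auto simp: pverts_T)
  show "finite (pverts T)" by (simp add: pverts_T)
  show "finite (parcs T)" using sub by (rule finite_subset) simp
  show "fst e \<noteq> snd e" if "e \<in> parcs T" for e
    using that up_neq by (cases e) (auto simp: parcs_T dest!: up_neq)
  show "symmetric T"
    by (auto simp: symmetric_def parcs_T intro!: symI)
qed

lemma spine_arc: "Suc i < M \<Longrightarrow> (i, Suc i) \<in> parcs T" "Suc i < M \<Longrightarrow> (Suc i, i) \<in> parcs T"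
  by (auto simp: parcs_T up_def)

lemma leaf_arc:
  assumes "M \<le> v" "v < M + n"
  shows "(v, foot v) \<in> parcs T" "(foot v, v) \<in> parcs T"
  using assms two_le_M by (auto simp: parcs_T up_def foot_def)

section \<open>Upper bounds on distances in the caterpillar\<close>

lemma spine_walk:
  assumes "i \<le> j" "j < M"
  shows "\<exists>es fs. awalk i es j \<and> awalk j fs i \<and>
    awalk_cost w es = \<eta> * real (j - i) \<and> awalk_cost w fs = \<eta> * real (j - i)"
  using assms
proof (induction j rule: dec_induct)
  case base
  then show ?case by (intro exI[of _ "[]"]) (simp add: awalk_Nil_iff pverts_T)
next
  case (step j)
  then obtain es fs where "awalk i es j" "awalk j fs i"
    "awalk_cost w es = \<eta> * real (j - i)" "awalk_cost w fs = \<eta> * real (j - i)" by auto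
  moreover have "awalk j [(j, Suc j)] (Suc j)" "awalk (Suc j) [(Suc j, j)] j"
    using spine_arc step.prems by (auto simp: awalk_simps pverts_T)
  moreover have "w (j, Suc j) = \<eta>" "w (Suc j, j) = \<eta>"
    using step.prems by (simp_all add: w_def)
  ultimately show ?case
    using step.hyps
    by (intro exI[of _ "es @ [(j, Suc j)]"] exI[of _ "[(Suc j, j)] @ fs"])
      (auto simp: Suc_diff_le algebra_simps intro: awalk_appendI simp del: append_Cons)
qed

lemma foot_walk:
  assumes "v < M + n"
  shows "\<exists>es fs. awalk v es (foot v) \<and> awalk (foot v) fs v \<and>
    awalk_cost w es \<le> 1 \<and> awalk_cost w fs \<le> 1"
proof (cases "v < M")
  case True
  then show ?thesis
    by (intro exI[of _ "[]"]) (simp add: awalk_Nil_iff pverts_T foot_def)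
next
  case False
  then show ?thesis
    using assms leaf_arc[of v] foot_less[of v]
    by (intro exI[of _ "[(v, foot v)]"] exI[of _ "[(foot v, v)]"])
      (auto simp: awalk_simps pverts_T w_def)
qed

text \<open>Walk to the spine, along it, and out again. This gives connectedness as well as
  distances of about 2 when \<open>\<eta> * M\<close> is small.\<close>

lemma short_walk:
  assumes "p < M + n" "q < M + n"
  shows "\<exists>es. awalk p es q \<and> awalk_cost w es \<le> 2 + \<eta> * M"
proof -
  have "\<exists>es. awalk i es j \<and> awalk_cost w es \<le> \<eta> * M" if ij: "i < M" "j < M" for i j
  proof -
    have "\<exists>es. awalk i es j \<and> (awalk_cost w es = \<eta> * real (j - i) \<or>
        awalk_cost w es = \<eta> * real (i - j))"
      using spine_walk[of i j] spine_walk[of j i] ij by (cases "i \<le> j") auto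
    moreover have "\<eta> * real (j - i) \<le> \<eta> * M" "\<eta> * real (i - j) \<le> \<eta> * M"
      using ij \<eta>_pos by auto
    ultimately show ?thesis by fastforce
  qed
  from this[OF foot_less[OF assms(1)] foot_less[OF assms(2)]]
  obtain es where "awalk (foot p) es (foot q)" "awalk_cost w es \<le> \<eta> * M" by blast
  moreover obtain ps where "awalk p ps (foot p)" "awalk_cost w ps \<le> 1"
    using foot_walk[OF assms(1)] by blast
  moreover obtain qs where "awalk (foot q) qs q" "awalk_cost w qs \<le> 1"
    using foot_walk[OF assms(2)] by blast
  ultimately show ?thesis
    by (intro exI[of _ "ps @ es @ qs"]) (auto intro!: awalk_appendI)
qed

sublocale bridge_tree T
proof
  show "p \<rightarrow>\<^sup>*\<^bsub>T\<^esub> q" if "p \<in> pverts T" "q \<in> pverts T" for p q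
    using short_walk[of p q] that by (auto simp: pverts_T reachable_awalk)
  show "\<exists>X. p \<in> X \<and> q \<notin> X \<and>
      (\<forall>b c. (b, c) \<in> parcs T \<longrightarrow> b \<in> X \<longrightarrow> c \<notin> X \<longrightarrow> b = p \<and> c = q)"
    if arc: "(p, q) \<in> parcs T" for p q
  proof -
    \<comment> \<open>The side of \<open>v\<close> after removal of the edge to its parent: an
      initial stretch of the spine with its leaves, or a single leaf. Arcs towards the root use it,
      arcs away from the root its complement.\<close>
    define Y where "Y v = (if v < M then {u. foot u \<le> v} else {v})" for v
    have cut: "v \<in> Y v \<and> up v \<notin> Y v \<and> (\<forall>b c. (b, c) \<in> parcs T \<longrightarrow>
        (b \<in> Y v \<longleftrightarrow> c \<in> Y v) \<or> (b, c) = (v, up v) \<or> (b, c) = (up v, v))"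
      if v: "v < M + n" "v \<noteq> M - 1" for v
    proof (intro conjI allI impI)
      show "v \<in> Y v" "up v \<notin> Y v"
        using v up_less[OF v] up_neq[OF v] by (auto simp: Y_def foot_def up_def)
      have *: "(b \<in> Y v \<longleftrightarrow> up b \<in> Y v) \<or> b = v" if "b < M + n" "b \<noteq> M - 1" for b
        using v that up_less[OF that] by (auto simp: Y_def foot_def up_def)
      show "(b \<in> Y v \<longleftrightarrow> c \<in> Y v) \<or> (b, c) = (v, up v) \<or> (b, c) = (up v, v)"
        if "(b, c) \<in> parcs T" for b c
        using *[of b] *[of c] that by (auto simp: parcs_T)
    qed
    consider "p < M + n" "p \<noteq> M - 1" "q = up p" | "q < M + n" "q \<noteq> M - 1" "p = up q"
      using arc by (auto simp: parcs_T)
    then show ?thesis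
    proof cases
      case 1
      then show ?thesis using cut[of p] by (intro exI[of _ "Y p"]) blast
    next
      case 2
      then show ?thesis using cut[of q] by (intro exI[of _ "- Y q"]) blast
    qed
  qed
qed

lemma leaves_T [simplified]: "leaves T (M - 1) = {M..<M + n}"
proof -
  have deg: "out_degree T v = card {(v, q) | q. (v, q) \<in> parcs T}" for v
    unfolding out_degree_def by (rule arg_cong[of _ _ card]) (auto simp: out_arcs_def)
  have leaf: "out_degree T v = 1" if "M \<le> v" "v < M + n" for v
  proof -
    have "{(v, q) | q. (v, q) \<in> parcs T} = {(v, up v)}"
      using that two_le_M up_less by (fastforce simp: parcs_T)
    then show ?thesis by (simp add: deg)
  qed
  have fin: "finite {(v, q) | q. (v, q) \<in> parcs T}" for v
    by (rule finite_subset[OF _ pair_finite_arcs]) auto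
  have root: "out_degree T (M - 1) \<noteq> 0"
  proof -
    have "(M - 1, M - 2) \<in> parcs T"
      using spine_arc(2)[of "M - 2"] two_le_M by (simp add: numeral_2_eq_2 Suc_diff_Suc)
    then show ?thesis using fin[of "M - 1"] by (auto simp: deg)
  qed
  \<comment> \<open>Besides its successor, a spine vertex has its predecessor as neighbour, or the
    leaf \<open>M\<close> if it is the vertex 0.\<close>
  have inner: "out_degree T v \<noteq> 1" if "v < M - 1" for v
  proof -
    have up: "(v, Suc v) \<in> parcs T" using spine_arc that by simp
    obtain u where u: "(v, u) \<in> parcs T" "u \<noteq> Suc v"
    proof (cases v)
      case 0
      have "(v, M) \<in> parcs T"
        using leaf_arc(2)[of M] n_pos a_0 0 by (simp add: foot_def)
      then show ?thesis using 0 two_le_M by (intro that[of M]) auto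
    next
      case (Suc i)
      then have "(v, i) \<in> parcs T" using spine_arc(2)[of i] \<open>v < M - 1\<close> by simp
      then show ?thesis using Suc by (intro that[of i]) auto
    qed
    have "card {(v, Suc v), (v, u)} \<le> out_degree T v"
      unfolding deg using up u by (intro card_mono fin) auto
    then show ?thesis using u(2) by auto
  qed
  show ?thesis
  proof (intro set_eqI iffI)
    fix v assume "v \<in> leaves T (M - 1)"
    then have "v < M + n" "out_degree T v = (if v = M - 1 then 0 else 1)"
      by (auto simp: leaves_def pverts_T)
    then have "v \<noteq> M - 1" "\<not> v < M - 1" using root inner[of v] by auto
    then show "v \<in> {M..<M + n}" using \<open>v < M + n\<close> by auto
  next
    fix v assume "v \<in> {M..<M + n}"
    then show "v \<in> leaves T (M - 1)" using leaf two_le_M by (auto simp: leaves_def pverts_T)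
  qed
qed

lemma w_pos: "0 < w e"
  using \<eta>_pos by (simp add: w_def split: prod.split)

lemma rooted_tree_T: "rooted_tree T (M - 1) w"
proof
  show "Digraph_Component.connected T"
    using n_pos by (intro connectedI reachable_mk_symmetricI reach)
      (auto simp: pverts_T lessThan_empty_iff)
qed (use cycle_length_less_3 two_le_M w_pos in \<open>auto simp: pverts_T w_def\<close>)

section \<open>Lipschitz functions on the caterpillar\<close>

lemma foot_Lipschitz:
  assumes "(p, q) \<in> parcs T"
  shows "\<bar>real (foot p) - real (foot q)\<bar> \<le> 1"
proof -
  have "\<bar>real (foot v) - real (foot (up v))\<bar> \<le> 1" if "v < M + n" "v \<noteq> M - 1" for v
    using up_less[OF that] by (auto simp: foot_def up_def)
  then show ?thesis using assms by (auto simp: parcs_T abs_minus_commute)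
qed

text \<open>No two leaves are adjacent and every leaf edge has weight 1. For distinct leaves
  \<open>x\<close> and \<open>y\<close> the values differ by 2, which bounds their distance from
  below.\<close>

lemma leaf_pair_Lipschitz:
  fixes f :: "nat \<Rightarrow> real"
  assumes "(p, q) \<in> parcs T" "M \<le> x" "M \<le> y"
  defines "f \<equiv> \<lambda>v. if v = x then 1 else if v = y then -1 else 0"
  shows "\<bar>f p - f q\<bar> \<le> w (p, q)"
proof -
  have "p < M \<or> q < M" using assms(1) up_less by (auto simp: parcs_T)
  then show ?thesis using assms(2,3) \<eta>_pos by (auto simp: f_def w_def)
qed

end

section \<open>Spanners of caterpillars\<close>

context caterpillar
begin

text \<open>
  Without exits, the first and the last link of a path from \<open>p\<close> to \<open>q\<close> join two leaves each, and
  they are joined by a path between two further distinct leaves. So the path has length at least 6,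
  about three times the distance of \<open>p\<close> and \<open>q\<close>.
\<close>

lemma spanner_link_exits:
  assumes spanner: "steiner_spanner \<tau> T (M - 1) w S T' w' G"
    and \<tau>: "0 \<le> \<tau>" "\<tau> * (2 + \<eta> * M) < 6"
    and p: "p \<in> leaves T (M - 1)" "p \<in> P" "P \<inter> S = {}"
    and q: "q \<in> leaves T (M - 1)" "q \<in> Q" "Q \<inter> S = {}"
    and disj: "P \<inter> Q = {}"
  shows "(\<exists>z. (p, z) \<in> parcs G \<and> z \<notin> P) \<or> (\<exists>z. (q, z) \<in> parcs G \<and> z \<notin> Q)"
proof (rule ccontr)
  assume no_exit: "\<not> ?thesis"
  define d where "d = (\<lambda>(a, b). tree_dist T' w' a b)"
  have placed: "steiner_placement T w T' w'" and sub: "S \<subseteq> pverts T'" and "pair_graph G"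
    and verts_G: "pverts G = leaves T (M - 1) \<union> S"
    and \<mu>: "wf_digraph.\<mu> G d p q \<le> ereal (\<tau> * tree_dist T w p q)"
    using spanner p(1) q(1) by (auto simp: steiner_spanner_def d_def)
  have T: "bridge_tree T" by unfold_locales
  interpret T': bridge_tree T' using steiner_placement_bridge_tree[OF placed T] by blast
  interpret G: pair_graph G by fact
  have verts: "pverts G \<subseteq> pverts T'"
    using steiner_placement_bridge_tree[OF placed T] sub
    by (auto simp: verts_G leaves_T pverts_T)
  \<comment> \<open>The walk may visit Steiner points; a Lipschitz extension to all of
    \<open>T'\<close> bounds its cost nevertheless.\<close>
  have two: "2 \<le> G.awalk_cost d es"
    if "G.awalk x es y" "x \<in> leaves T (M - 1)" "y \<in> leaves T (M - 1)" "x \<noteq> y" for x y es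
  proof -
    define f :: "nat \<Rightarrow> real" where "f = (\<lambda>v. if v = x then 1 else if v = y then -1 else 0)"
    have f: "\<bar>f a - f b\<bar> \<le> w (a, b)" if "(a, b) \<in> parcs T" for a b
      unfolding f_def using \<open>x \<in> _\<close> \<open>y \<in> _\<close> that
      by (intro leaf_pair_Lipschitz) (auto simp: leaves_T)
    obtain g where g: "\<And>v. v \<in> pverts T \<Longrightarrow> g v = f v"
      and Lip: "\<And>a b. (a, b) \<in> parcs T' \<Longrightarrow> \<bar>g a - g b\<bar> \<le> w' (a, b)"
      by (rule steiner_placement_extend_Lipschitz[OF placed T, of f]) (use f in blast)
    have "\<bar>g x - g y\<bar> \<le> G.awalk_cost d es"
    proof (rule G.Lipschitz_le_awalk_cost[OF that(1)])
      fix e assume "e \<in> parcs G"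
      then have "fst e \<in> pverts T'" "snd e \<in> pverts T'"
        using verts G.arc_fst_in_verts G.arc_snd_in_verts by blast+
      then show "\<bar>g (fst e) - g (snd e)\<bar> \<le> d e"
        using T'.Lipschitz_le_tree_dist[of "fst e" "snd e" g w'] Lip
        by (simp add: d_def case_prod_unfold)
    qed
    moreover have "g x = 1" "g y = -1"
      using g that by (auto simp: leaves_T pverts_T f_def)
    ultimately show ?thesis by simp
  qed
  have "p < M + n" "q < M + n" using p(1) q(1) by (auto simp: leaves_T)
  then obtain ps where "awalk p ps q" "awalk_cost w ps \<le> 2 + \<eta> * M"
    using short_walk by blast
  then have "tree_dist T w p q \<le> 2 + \<eta> * M"
    using tree_dist_le_awalk_cost[of p ps q w] less_imp_le[OF w_pos] by force
  then have "\<tau> * tree_dist T w p q \<le> \<tau> * (2 + \<eta> * M)"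
    using \<tau>(1) by (rule mult_left_mono)
  then have "G.\<mu> d p q < ereal 6"
    using \<mu> \<tau>(2) by (meson ereal_less(2) le_less_trans less_ereal.simps(1))
  then obtain es where walk: "G.awalk p es q" and short: "G.awalk_cost d es < 6"
    by (auto simp: G.\<mu>_def INF_less_iff)
  have "p \<noteq> q" using p q disj by auto
  then obtain x es' where es: "es = (p, x) # es'" and px: "(p, x) \<in> parcs G" and x: "G.awalk x es' q"
    using walk by (cases es) (auto simp: G.awalk_simps)
  have "x \<in> P" using px no_exit by auto
  \<comment> \<open>A vertex of the spanner outside \<open>S\<close> is a leaf.\<close>
  have "x \<in> leaves T (M - 1)"
    using \<open>x \<in> P\<close> p(3) G.in_arcsD2[OF px] verts_G by auto
  have "x \<noteq> q" using \<open>x \<in> P\<close> q disj by auto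
  then have "es' \<noteq> []" using x by (auto simp: G.awalk_simps)
  then obtain y fs where es': "es' = fs @ [(y, q)]" and yq: "(y, q) \<in> parcs G" and y: "G.awalk x fs y"
    using x by (cases es' rule: rev_cases) (auto simp: G.awalk_simps)
  have qy: "(q, y) \<in> parcs G" using yq by (rule G.arcs_symmetric)
  have "y \<in> Q" using qy no_exit by auto
  have "y \<in> leaves T (M - 1)"
    using \<open>y \<in> Q\<close> q(3) G.in_arcsD2[OF qy] verts_G by auto
  have "2 \<le> G.awalk_cost d [(p, x)]"
    using px G.no_loops'[OF px] p(1) \<open>x \<in> leaves T (M - 1)\<close> G.in_arcsD1[OF px] G.in_arcsD2[OF px]
    by (intro two[of p _ x]) (auto simp: G.awalk_simps)
  moreover have "2 \<le> G.awalk_cost d fs"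
    using y \<open>x \<in> leaves T (M - 1)\<close> \<open>y \<in> leaves T (M - 1)\<close> \<open>x \<in> P\<close> \<open>y \<in> Q\<close> disj
    by (intro two[of x _ y]) auto
  moreover have "2 \<le> G.awalk_cost d [(y, q)]"
    using yq G.no_loops'[OF yq] q(1) \<open>y \<in> leaves T (M - 1)\<close> G.in_arcsD1[OF yq] G.in_arcsD2[OF yq]
    by (intro two[of y _ q]) (auto simp: G.awalk_simps)
  ultimately show False using short by (simp add: es es')
qed

end

text \<open>
  At least \<open>K - card S\<close> of the \<open>K\<close> bunches of leaves have no Steiner point nearby. In all but at
  most one of these, every leaf has a link that bridges half of the gap of \<open>L\<close> spine edges.
\<close>

lemma caterpillar_spanner_complexity:
  fixes M n K L :: nat and \<eta> \<tau> :: real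
  defines "a \<equiv> \<lambda>j. (j mod K) * L"
  assumes "caterpillar M n a \<eta>"
  defines "T \<equiv> caterpillar.T M n a" and "w \<equiv> caterpillar.w M \<eta>"
  assumes spanner: "steiner_spanner \<tau> T (M - 1) w S T' w' G"
    and \<tau>: "0 \<le> \<tau>" "\<tau> * (2 + \<eta> * M) < 6"
    and L: "0 < L" and K: "0 < K" and S: "finite S"
  shows "real ((K - card S - 1) * (n div K)) * L \<le> 4 * spanner_complexity T' G"
proof -
  interpret T: caterpillar M n a \<eta> by fact
  have T_eq: "T = T.T" "w = T.w" by (simp_all add: T_def w_def)
  have bT: "bridge_tree T.T" by unfold_locales
  have placed: "steiner_placement T.T T.w T' w'" and sub: "S \<subseteq> pverts T'" and "pair_graph G"
    and verts_G: "pverts G = leaves T.T (M - 1) \<union> S"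
    using spanner by (auto simp: steiner_spanner_def T_eq)
  interpret T': bridge_tree T' using steiner_placement_bridge_tree[OF placed bT] by blast
  interpret G: pair_graph G by fact
  have verts: "pverts G \<subseteq> pverts T'"
    using steiner_placement_bridge_tree[OF placed bT] sub
    by (auto simp: verts_G T.leaves_T T.pverts_T)
  obtain g where g: "\<And>v. v \<in> pverts T.T \<Longrightarrow> g v = real (T.foot v)"
    and Lip: "\<And>a b. (a, b) \<in> parcs T' \<Longrightarrow> \<bar>g a - g b\<bar> \<le> 1"
    by (rule steiner_placement_extend_Lipschitz[OF placed bT, of "\<lambda>v. real (T.foot v)"])
      (use T.foot_Lipschitz in blast)
  \<comment> \<open>The open region of half a gap around the foot of bunch \<open>i\<close>,
    measured by \<open>g\<close> so that placed points are covered too. Regions are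
    disjoint.\<close>
  define R where "R i = {z. 2 * \<bar>g z - real i * L\<bar> < L}" for i
  have near: "\<bar>x - y\<bar> < l" if "2 * \<bar>u - x\<bar> < l" "2 * \<bar>u - y\<bar> < l" for u x y l :: real
    using that by (simp add: abs_if split: if_splits)
  have R_unique: "i = j" if "z \<in> R i" "z \<in> R j" for z i j
  proof (rule ccontr)
    assume "i \<noteq> j"
    then have "1 \<le> \<bar>real i - real j\<bar>" by linarith
    then have "1 * real L \<le> \<bar>real i - real j\<bar> * L" by (intro mult_right_mono) auto
    also have "\<dots> = \<bar>real i * L - real j * L\<bar>" by (simp add: abs_mult flip: left_diff_distrib)
    also have "\<dots> < L" using that unfolding R_def mem_Collect_eq by (rule near)
    finally show False by simp
  qed
  have g_leaf: "g (M + j) = real (j mod K) * L" if "j < n" for j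
  proof -
    have "g (M + j) = real (a j)" using that by (simp add: g T.pverts_T T.foot_def)
    then show ?thesis by (simp add: a_def)
  qed
  have leaf_R: "M + j \<in> R (j mod K)" if "j < n" for j
    using that L by (simp add: R_def g_leaf)
  define F where "F = {i. i < K \<and> R i \<inter> S = {}}"
  define exits where "exits j \<longleftrightarrow> (\<exists>z. (M + j, z) \<in> parcs G \<and> z \<notin> R (j mod K))" for j
  \<comment> \<open>The Steiner-free bunches containing a leaf without exit; two of them would
    contradict \<open>spanner_link_exits\<close>.\<close>
  define B where "B = {i \<in> F. \<exists>j < n. j mod K = i \<and> \<not> exits j}"
  have card_F: "K - card S \<le> card F"
  proof -
    \<comment> \<open>By disjointness, a Steiner point determines the only bunch that it can
      spoil.\<close>
    have "{..<K} - F \<subseteq> (\<lambda>s. THE i. s \<in> R i) ` S"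
    proof
      fix i assume "i \<in> {..<K} - F"
      then obtain s where s: "s \<in> R i" "s \<in> S" by (auto simp: F_def)
      then have "(THE i. s \<in> R i) = i" using R_unique by blast
      then show "i \<in> (\<lambda>s. THE i. s \<in> R i) ` S" using s(2) by force
    qed
    then have "card ({..<K} - F) \<le> card S" using S by (rule surj_card_le[rotated])
    moreover have "card ({..<K} - F) = K - card F"
      using card_Diff_subset[of F "{..<K}"] by (auto simp: F_def)
    ultimately show ?thesis by simp
  qed
  have B_unique: "i = j" if ij: "i \<in> B" "j \<in> B" for i j
  proof (rule ccontr)
    assume "i \<noteq> j"
    obtain s t where st: "s < n" "s mod K = i" "\<not> exits s" "t < n" "t mod K = j" "\<not> exits t"
      using ij by (auto simp: B_def)
    have "(\<exists>z. (M + s, z) \<in> parcs G \<and> z \<notin> R i) \<or> (\<exists>z. (M + t, z) \<in> parcs G \<and> z \<notin> R j)"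
      using spanner \<tau>
    proof (rule T.spanner_link_exits[of \<tau> S T' w', folded T_eq])
      show "M + s \<in> R i" "M + t \<in> R j" using leaf_R st by blast+
      show "R i \<inter> R j = {}" using R_unique \<open>i \<noteq> j\<close> by blast
      show "R i \<inter> S = {}" "R j \<inter> S = {}" using ij by (auto simp: B_def F_def)
    qed (use st in \<open>auto simp: T_eq T.leaves_T\<close>)
    then show False using st by (auto simp: exits_def)
  qed
  have card_B: "card B \<le> 1"
  proof (cases "B = {}")
    case False
    then obtain i where "i \<in> B" by blast
    then have "B \<subseteq> {i}" using B_unique by blast
    then show ?thesis using card_mono[of "{i}" B] by simp
  qed simp
  have "finite F" by (simp add: F_def)
  then have "card F - card B \<le> card (F - B)" by (intro diff_card_le_card_Diff) (auto simp: B_def)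
  then have card_FB: "K - card S - 1 \<le> card (F - B)" using card_F card_B by linarith
  define E where "E = {j. j < n \<and> exits j}"
  \<comment> \<open>Bunch \<open>i\<close> consists of the leaves with index
    \<open>t * K + i\<close>, and every \<open>t < n div K\<close> gives one.\<close>
  have "card ((F - B) \<times> {..<n div K}) \<le> card E"
  proof (rule card_inj_on_le)
    let ?h = "\<lambda>(i, t). t * K + i"
    show "inj_on ?h ((F - B) \<times> {..<n div K})"
    proof (rule inj_onI, clarify)
      fix i t i' t' assume *: "i \<in> F" "i' \<in> F" "t * K + i = t' * K + i'"
      then have "i < K" "i' < K" by (auto simp: F_def)
      moreover have "(t * K + i) mod K = (t' * K + i') mod K" "(t * K + i) div K = (t' * K + i') div K"
        using *(3) by simp_all
      ultimately show "i = i' \<and> t = t'" by simp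
    qed
    show "?h ` ((F - B) \<times> {..<n div K}) \<subseteq> E"
    proof clarify
      fix i t assume *: "i \<in> F" "i \<notin> B" "t < n div K"
      have "i < K" using *(1) by (simp add: F_def)
      have "Suc t * K \<le> n div K * K" using *(3) by (intro mult_right_mono) auto
      also have "\<dots> \<le> n" by simp
      finally have "t * K + i < n" using \<open>i < K\<close> by simp
      moreover have "(t * K + i) mod K = i" using \<open>i < K\<close> by simp
      ultimately show "t * K + i \<in> E" using * by (auto simp: B_def E_def)
    qed
  qed (simp add: E_def)
  then have "card (F - B) * (n div K) \<le> card E" by (simp add: card_cartesian_product)
  then have card_E: "(K - card S - 1) * (n div K) \<le> card E"
    using card_FB by (meson mult_le_mono1 order_trans)
  define z where "z j = (SOME z. (M + j, z) \<in> parcs G \<and> z \<notin> R (j mod K))" for j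
  have z: "(M + j, z j) \<in> parcs G" "z j \<notin> R (j mod K)" if "j \<in> E" for j
    using someI_ex[of "\<lambda>z. (M + j, z) \<in> parcs G \<and> z \<notin> R (j mod K)"] that
    by (auto simp: E_def exits_def z_def)
  have long: "real L / 2 \<le> length (tree_path T' (M + j) (z j))" if "j \<in> E" for j
  proof -
    have "M + j \<in> pverts T'" "z j \<in> pverts T'"
      using z(1)[OF that] verts G.wellformed' by blast+
    then have "\<bar>g (M + j) - g (z j)\<bar> \<le> length (tree_path T' (M + j) (z j))"
      using Lip by (rule T'.Lipschitz_le_length_tree_path)
    moreover have "real L \<le> 2 * \<bar>g (M + j) - g (z j)\<bar>"
      using z(2)[OF that] g_leaf[of j] that by (auto simp: R_def E_def abs_minus_commute)
    ultimately show ?thesis by simp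
  qed
  have "real (card E) * (real L / 2) \<le> (\<Sum>j \<in> E. real (length (tree_path T' (M + j) (z j))))"
    using long sum_mono[of E "\<lambda>_. real L / 2"] by simp
  \<comment> \<open>Distinct leaves give distinct arcs, but one link may be the chosen exit of both
    of its ends; hence arcs are counted.\<close>
  also have "\<dots> = (\<Sum>(p, q) \<in> (\<lambda>j. (M + j, z j)) ` E. real (length (tree_path T' p q)))"
    by (subst sum.reindex) (auto simp: inj_on_def)
  also have "\<dots> \<le> (\<Sum>(p, q) \<in> parcs G. real (length (tree_path T' p q)))"
    using z(1) by (intro sum_mono2 G.pair_finite_arcs) auto
  \<comment> \<open>One factor 2 stems from the half gap, the other from the two arcs of a
    link.\<close>
  finally have "real (card E) * L \<le> 4 * spanner_complexity T' G"
    by (simp add: spanner_complexity_def)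
  moreover have "real ((K - card S - 1) * (n div K)) * L \<le> real (card E) * L"
    using card_E by (intro mult_right_mono) (simp_all only: of_nat_le_iff of_nat_0_le_iff)
  ultimately show ?thesis by linarith
qed

section \<open>Choice of the parameters\<close>

theorem lemma4:
  fixes \<epsilon> :: real
  assumes "0 < \<epsilon>" and "\<epsilon> < 1"
  shows "\<exists>c C :: real. 0 < c \<and> 0 < C \<and>
    (\<forall>n m k :: nat. 0 < n \<longrightarrow> 0 < m \<longrightarrow> 0 < k \<longrightarrow>
      real k < real n / 2 \<longrightarrow> C * real n \<le> real m \<longrightarrow>
      (\<exists>(T :: nat pair_pre_digraph) r w.
        rooted_tree T r w \<and> card (leaves T r) = n \<and> card (pverts T) = m \<and>
        (\<forall>S T' w' G. card S = k \<longrightarrow> steiner_spanner (3 - \<epsilon>) T r w S T' w' G \<longrightarrow>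
          c * real m * real n / real k \<le> spanner_complexity T' G)))"
proof (rule exI[of _ "1 / 288"], rule exI[of _ 2], intro conjI allI impI)
  fix n m k :: nat
  assume pos: "0 < n" "0 < m" "0 < k" and "real k < real n / 2" and "2 * real n \<le> real m"
  then have k: "2 * k < n" and m: "2 * n \<le> m" by linarith+
  \<comment> \<open>At most \<open>n\<close> bunches, so that none is empty; at most
    \<open>3 * k\<close>, so that the gaps have order \<open>m / k\<close>.\<close>
  define K where "K = min n (3 * k)"
  \<comment> \<open>All vertices but the leaves form the spine; \<open>C = 2\<close> makes it at
    least half of the tree.\<close>
  define M where "M = m - n"
  define L where "L = M div K"
  \<comment> \<open>The spine weight is about \<open>\<epsilon> / 3\<close>, which leaves
    \<open>(3 - \<epsilon>) * (2 + \<epsilon> / 3)\<close> below 6.\<close>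
  define \<eta> where "\<eta> = \<epsilon> / (3 * M)"
  define a where "a = (\<lambda>j. (j mod K) * L)"
  \<comment> \<open>The last bound says that a third of the bunches survives the loss of
    \<open>k\<close> spoiled ones and one exception; for \<open>K = n\<close> it uses
    \<open>2 * k < n\<close>.\<close>
  have K: "0 < K" "K \<le> n" "K \<le> 3 * k" "K \<le> 3 * (K - k - 1)"
    using pos k by (auto simp: K_def)
  have M: "3 \<le> M" "K \<le> M" "m = M + n" "m \<le> 2 * M"
    using m k pos K(2) by (auto simp: M_def)
  have L: "0 < L" using K M by (simp add: L_def div_greater_zero_iff)
  interpret caterpillar M n a \<eta>
  proof
    show "a j < M" for j
    proof -
      have "j mod K * L < K * L" using K(1) L by simp
      also have "\<dots> \<le> M" by (simp add: L_def)
      finally show ?thesis by (simp add: a_def)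
    qed
  qed (use M pos assms in \<open>auto simp: a_def \<eta>_def\<close>)
  have "(3 - \<epsilon>) * (2 + \<eta> * M) < 6"
  proof -
    have "(3 - \<epsilon>) * (2 + \<eta> * M) = 6 - \<epsilon> - \<epsilon> * \<epsilon> / 3"
      using M(1) by (simp add: \<eta>_def field_simps)
    moreover have "0 < \<epsilon> * \<epsilon>" using assms(1) by simp
    ultimately show ?thesis using assms(1) by linarith
  qed
  have "real m * real n / (288 * real k) \<le> spanner_complexity T' G"
    if "card S = k" "steiner_spanner (3 - \<epsilon>) T (M - 1) w S T' w' G" for S T' w' G
  proof -
    \<comment> \<open>An infinite set has cardinality 0, but \<open>k\<close> is positive.\<close>
    have "finite S" using that(1) pos(3) by (metis card.infinite less_irrefl)
    have cat: "caterpillar M n (\<lambda>j. (j mod K) * L) \<eta>"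
      using caterpillar_axioms by (simp add: a_def)
    have "real ((K - k - 1) * (n div K)) * L \<le> 4 * spanner_complexity T' G"
      using caterpillar_spanner_complexity[OF cat, of "3 - \<epsilon>" S T' w' G] that assms(2)
        \<open>(3 - \<epsilon>) * (2 + \<eta> * M) < 6\<close> L K(1) \<open>finite S\<close> by (simp add: a_def)
    moreover have "real m * real n \<le> 72 * real k * (real ((K - k - 1) * (n div K)) * L)"
    proof -
      \<comment> \<open>The quotient is at least 1, so rounding down loses at most a factor
        2.\<close>
      have half: "x \<le> 2 * (K * (x div K))" if "K \<le> x" for x
      proof -
        have "1 \<le> x div K" using that K(1) by (simp add: div_greater_zero_iff Suc_le_eq)
        then have "K * 1 \<le> K * (x div K)" by (rule mult_left_mono) simp
        moreover have "x mod K < K" using K(1) by simp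
        moreover have "x = K * (x div K) + x mod K" by simp
        ultimately show ?thesis by linarith
      qed
      \<comment> \<open>Factors of 2 come from \<open>m \<le> 2 * M\<close> and from each of the two
        divisions. The estimate of \<open>K * K\<close> adds 9, giving 72, and the 4 of the
        complexity bound makes it 288.\<close>
      have "m * n \<le> (2 * (2 * (K * L))) * (2 * (K * (n div K)))"
        using M(4) half[OF M(2)] half[OF K(2)] by (intro mult_mono) (auto simp: L_def)
      also have "\<dots> = 8 * (K * K) * ((n div K) * L)" by simp
      also have "\<dots> \<le> 8 * ((3 * (K - k - 1)) * (3 * k)) * ((n div K) * L)"
        using K by (intro mult_right_mono mult_left_mono mult_mono) auto
      also have "\<dots> = 72 * k * ((K - k - 1) * (n div K) * L)" by simp
      finally have "real (m * n) \<le> real (72 * k * ((K - k - 1) * (n div K) * L))"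
        by (simp only: of_nat_le_iff)
      then show ?thesis by (simp add: mult.assoc)
    qed
    ultimately have "real m * real n \<le> 72 * real k * (4 * spanner_complexity T' G)"
      by (meson mult_left_mono of_nat_0_le_iff order_trans zero_le_mult_iff zero_le_numeral)
    then show ?thesis using pos(3) by (simp add: field_simps)
  qed
  then show "\<exists>(T :: nat pair_pre_digraph) r w.
        rooted_tree T r w \<and> card (leaves T r) = n \<and> card (pverts T) = m \<and>
        (\<forall>S T' w' G. card S = k \<longrightarrow> steiner_spanner (3 - \<epsilon>) T r w S T' w' G \<longrightarrow>
          1 / 288 * real m * real n / real k \<le> spanner_complexity T' G)"
    using rooted_tree_T M(3)
    by (intro exI[of _ T] exI[of _ "M - 1"] exI[of _ w]) (auto simp: leaves_T pverts_T)
qed simp_all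

end
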